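(* Let $A, B \subseteq \omega$ be computably enumerable sets such that $A \equiv_{wtt} B$, $A \cap B = \emptyset$, and $\omega \setminus (A \cup B)$ is infinite. Then for every set $C \subseteq \omega$ with $C \ge_T A$, there is a separator $Z$ of $A$ and $B$ such that $Z \equiv_T C$.
   Context: A separator of disjoint sets $A, B \subseteq \omega$ is a set $Z \subseteq \omega$ with $A \subseteq Z$ and $Z \cap B = \emptyset$. Here $\le_T$ is Turing reducibility, and $\le_{wtt}$ is weak truth table reducibility: $X \le_{wtt} Y$ if $X$ is computed from oracle $Y$ by a Turing functional whose use on that computation is bounded by a computable function of the input. $A \equiv_{wtt} B$ means $A \le_{wtt} B$ and $B \le_{wtt} A$; $\equiv_T$ is defined analogously. *)

theory Defs
  imports Main
begin

text \<open>
  Oracle Turing machines are represented by \<open>\<mu>\<close>-recursive programs with an additional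
  instruction \<open>Query\<close>, the characteristic function of the oracle.  Programs carry no
  arity: \<open>Zero\<close> is the constant zero function of every arity, \<open>Proj i\<close> applies to every
  list with more than \<open>i\<close> entries, and a program without an applicable rule diverges.
\<close>

datatype prog =
    Zero
  | Succ
  | Proj nat
  | Query
  | Comp prog "prog list"
  | PrimRec prog prog
  | Mu prog

text \<open>
  \<open>eval X p xs y Q\<close>: with oracle \<open>X\<close>, the program \<open>p\<close> halts on input \<open>xs\<close> with output \<open>y\<close>,
  and \<open>Q\<close> is the set of all numbers about which the oracle is queried along the way.
\<close>

inductive eval :: "nat set \<Rightarrow> prog \<Rightarrow> nat list \<Rightarrow> nat \<Rightarrow> nat set \<Rightarrow> bool" for X :: "nat set" where
  eval_Zero: "eval X Zero xs 0 {}"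
| eval_Succ: "eval X Succ [x] (Suc x) {}"
| eval_Proj: "i < length xs \<Longrightarrow> eval X (Proj i) xs (xs ! i) {}"
| eval_Query: "eval X Query [x] (of_bool (x \<in> X)) {x}"
| eval_Comp:
    "\<lbrakk>length ys = length gs; \<forall>i<length gs. eval X (gs ! i) xs (ys ! i) (Qs i); eval X f ys z R\<rbrakk>
     \<Longrightarrow> eval X (Comp f gs) xs z ((\<Union>i<length gs. Qs i) \<union> R)"
| eval_PrimRec_0:
    "eval X f xs y Q \<Longrightarrow> eval X (PrimRec f g) (0 # xs) y Q"
| eval_PrimRec_Suc:
    "\<lbrakk>eval X (PrimRec f g) (n # xs) y Q; eval X g (n # y # xs) z R\<rbrakk>
     \<Longrightarrow> eval X (PrimRec f g) (Suc n # xs) z (Q \<union> R)"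
| eval_Mu:
    "\<lbrakk>\<forall>i<n. eval X f (i # xs) (Suc (ys i)) (Qs i); eval X f (n # xs) 0 R\<rbrakk>
     \<Longrightarrow> eval X (Mu f) xs n ((\<Union>i<n. Qs i) \<union> R)"

inductive_cases eval_ZeroE: "eval X Zero xs y Q"
inductive_cases eval_SuccE: "eval X Succ xs y Q"
inductive_cases eval_ProjE: "eval X (Proj i) xs y Q"
inductive_cases eval_QueryE: "eval X Query xs y Q"
inductive_cases eval_CompE: "eval X (Comp f gs) xs y Q"
inductive_cases eval_PrimRec_0E: "eval X (PrimRec f g) (0 # xs) y Q"
inductive_cases eval_PrimRec_SucE: "eval X (PrimRec f g) (Suc n # xs) y Q"
inductive_cases eval_MuE: "eval X (Mu f) xs y Q"

lemma eval_deterministic: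
  "eval X p xs y Q \<Longrightarrow> eval X p xs y' Q' \<Longrightarrow> y' = y \<and> Q' = Q"
proof (induction arbitrary: y' Q' rule: eval.induct)
  case (eval_Zero xs)
  then show ?case by (auto elim: eval_ZeroE)
next
  case (eval_Succ x)
  then show ?case by (auto elim: eval_SuccE)
next
  case (eval_Proj i xs)
  from eval_Proj(2) show ?case by (auto elim: eval_ProjE)
next
  case (eval_Query x)
  then show ?case by (auto elim: eval_QueryE)
next
  case (eval_Comp ys gs xs Qs f z R)
  from eval_Comp.prems obtain ys' Qs' R' where
    len: "length ys' = length gs" and
    gs: "\<forall>i<length gs. eval X (gs ! i) xs (ys' ! i) (Qs' i)" and
    f: "eval X f ys' y' R'" and Q': "Q' = (\<Union>i<length gs. Qs' i) \<union> R'"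
    by (auto elim: eval_CompE)
  have eq: "ys' ! i = ys ! i \<and> Qs' i = Qs i" if "i < length gs" for i
    using eval_Comp.IH(1) gs that by blast
  then have "ys' = ys"
    using len eval_Comp.hyps(1) by (simp add: nth_equalityI)
  with f eval_Comp.IH(2) have "y' = z" "R' = R" by blast+
  with Q' eq show ?case by auto
next
  case (eval_PrimRec_0 f xs y Q g)
  from eval_PrimRec_0.prems eval_PrimRec_0.IH show ?case
    by (auto elim: eval_PrimRec_0E)
next
  case (eval_PrimRec_Suc f g n xs y Q z R)
  from eval_PrimRec_Suc.prems obtain y1 Q1 R1 where
    "eval X (PrimRec f g) (n # xs) y1 Q1" "eval X g (n # y1 # xs) y' R1" "Q' = Q1 \<union> R1"
    by (auto elim: eval_PrimRec_SucE)
  with eval_PrimRec_Suc.IH show ?case by blast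
next
  case (eval_Mu n f xs ys Qs R)
  from eval_Mu.prems obtain ys' Qs' R' where
    less: "\<forall>i<y'. eval X f (i # xs) (Suc (ys' i)) (Qs' i)" and
    zero: "eval X f (y' # xs) 0 R'" and Q': "Q' = (\<Union>i<y'. Qs' i) \<union> R'"
    by (auto elim: eval_MuE)
  have "\<not> y' < n" using eval_Mu.IH(1) zero by blast
  moreover have "\<not> n < y'" using eval_Mu.IH(2) less by blast
  ultimately have y': "y' = n" by simp
  with zero eval_Mu.IH(2) have "R' = R" by blast
  moreover have "Qs' i = Qs i" if "i < n" for i
    using eval_Mu.IH(1) less that y' by blast
  ultimately show ?case using Q' y' by auto
qed

fun oracle_free :: "prog \<Rightarrow> bool" where
  "oracle_free Zero \<longleftrightarrow> True"
| "oracle_free Succ \<longleftrightarrow> True"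
| "oracle_free (Proj i) \<longleftrightarrow> True"
| "oracle_free Query \<longleftrightarrow> False"
| "oracle_free (Comp f gs) \<longleftrightarrow> oracle_free f \<and> (\<forall>g \<in> set gs. oracle_free g)"
| "oracle_free (PrimRec f g) \<longleftrightarrow> oracle_free f \<and> oracle_free g"
| "oracle_free (Mu f) \<longleftrightarrow> oracle_free f"

text \<open>The oracle \<open>{}\<close> and the query set play no role for oracle-free programs.\<close>

definition computable :: "(nat \<Rightarrow> nat) \<Rightarrow> bool" where
  "computable h \<longleftrightarrow> (\<exists>p. oracle_free p \<and> (\<forall>n. \<exists>Q. eval {} p [n] (h n) Q))"

definition computably_enumerable :: "nat set \<Rightarrow> bool" where
  "computably_enumerable A \<longleftrightarrow> (\<exists>p. oracle_free p \<and> A = {n. \<exists>y Q. eval {} p [n] y Q})"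

definition turing_reducible :: "nat set \<Rightarrow> nat set \<Rightarrow> bool" (infix "\<le>\<^sub>T" 50) where
  "X \<le>\<^sub>T Y \<longleftrightarrow> (\<exists>p. \<forall>n. \<exists>Q. eval Y p [n] (of_bool (n \<in> X)) Q)"

definition wtt_reducible :: "nat set \<Rightarrow> nat set \<Rightarrow> bool" (infix "\<le>\<^sub>w\<^sub>t\<^sub>t" 50) where
  "X \<le>\<^sub>w\<^sub>t\<^sub>t Y \<longleftrightarrow> (\<exists>p h. computable h \<and>
     (\<forall>n. \<exists>Q. eval Y p [n] (of_bool (n \<in> X)) Q \<and> (\<forall>q \<in> Q. q < h n)))"

definition turing_equivalent :: "nat set \<Rightarrow> nat set \<Rightarrow> bool" (infix "\<equiv>\<^sub>T" 50) where
  "X \<equiv>\<^sub>T Y \<longleftrightarrow> X \<le>\<^sub>T Y \<and> Y \<le>\<^sub>T X"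

definition wtt_equivalent :: "nat set \<Rightarrow> nat set \<Rightarrow> bool" (infix "\<equiv>\<^sub>w\<^sub>t\<^sub>t" 50) where
  "X \<equiv>\<^sub>w\<^sub>t\<^sub>t Y \<longleftrightarrow> X \<le>\<^sub>w\<^sub>t\<^sub>t Y \<and> Y \<le>\<^sub>w\<^sub>t\<^sub>t X"

definition separator :: "nat set \<Rightarrow> nat set \<Rightarrow> nat set \<Rightarrow> bool" where
  "separator Z A B \<longleftrightarrow> A \<subseteq> Z \<and> Z \<inter> B = {}"

end

theory Submission
  imports Defs
begin

text \<open>
  Let \<open>D\<close> be the complement of \<open>A \<union> B\<close>. Every separator used has the form
  \<open>Z = A \<union> {x \<in> D. g x \<in> C}\<close> with \<open>g\<close> computable in \<open>A\<close>, so \<open>Z \<le>\<^sub>T C\<close> is clear.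
  Choose a computable increasing \<open>M\<close> above the use bounds of both reductions.

  If \<open>D \<inter> {m..<M m}\<close> is empty for only finitely many \<open>m\<close>, cut \<open>\<omega>\<close> into computable blocks that
  all meet \<open>D\<close> and let \<open>g\<close> be the block number. On block \<open>k\<close>, \<open>Z\<close> equals \<open>A\<close> if \<open>k \<notin> C\<close> and the
  complement of \<open>B\<close> if \<open>k \<in> C\<close>; the enumerations confirm exactly one of these.

  Otherwise \<open>D\<close> has infinitely many gaps, where a gap follows \<open>e \<in> D\<close> if the next element of \<open>D\<close>
  is at least \<open>M e\<close>, and \<open>g x\<close> counts the gaps before \<open>x\<close>. Thus \<open>Z\<close> is constant on each gap-free
  stretch of \<open>D\<close>, and \<open>Z\<close> can search for a stage at which the reductions agree with the
  enumerations and, for every undecided \<open>w \<le> x\<close>, \<open>Z\<close> is constant on the undecided elements of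
  \<open>{w..<M w}\<close>. Such a stage is correct up to \<open>x\<close>: if \<open>w\<close> were the least later change, then by the
  reductions both \<open>A\<close> and \<open>B\<close> would gain an undecided element of \<open>{w..<M w}\<close>, but \<open>Z\<close> contains the
  former and not the latter. So \<open>A \<le>\<^sub>T Z\<close>, hence \<open>Z\<close> knows \<open>g\<close> and recovers \<open>C\<close>.
\<close>

section \<open>Dependence of computations on the oracle\<close>

text \<open>The use principle: a halting computation sees the oracle only through its queries. The
  query set is preserved as well, so bounds on it carry over.\<close>

lemma eval_use:
  assumes "eval X p xs y Q" "\<And>q. q \<in> Q \<Longrightarrow> q \<in> X \<longleftrightarrow> q \<in> Y"
  shows "eval Y p xs y Q"
  using assms
proof (induction rule: eval.induct)
  case (eval_Query x)
  then show ?case using eval.eval_Query[of Y x] by auto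
next
  case (eval_Comp ys gs xs Qs f z R)
  then show ?case by (intro eval.eval_Comp) auto
next
  case (eval_Mu n f xs ys Qs R)
  then show ?case by (intro eval.eval_Mu) auto
qed (auto intro: eval.intros)

lemma oracle_free_no_queries:
  assumes "eval X p xs y Q" "oracle_free p"
  shows "Q = {}"
  using assms by (induction rule: eval.induct) auto

lemma oracle_free_eval:
  assumes "eval X p xs y Q" "oracle_free p"
  shows "eval Y p xs y Q"
  using eval_use[OF assms(1)] oracle_free_no_queries[OF assms] by blast

section \<open>Functions computable in an oracle\<close>

text \<open>Programs carry no arity, so \<open>k\<close> fixes the length of the argument lists.
  Values of \<open>f\<close> on lists of other lengths are unconstrained.\<close>

definition rec_in :: "nat set \<Rightarrow> nat \<Rightarrow> (nat list \<Rightarrow> nat) \<Rightarrow> bool" where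
  "rec_in X k f \<longleftrightarrow> (\<exists>p. \<forall>xs. length xs = k \<longrightarrow> (\<exists>Q. eval X p xs (f xs) Q))"

definition recs_in :: "nat set \<Rightarrow> nat \<Rightarrow> nat \<Rightarrow> (nat list \<Rightarrow> nat list) \<Rightarrow> bool" where
  "recs_in X k n G \<longleftrightarrow> (\<forall>xs. length xs = k \<longrightarrow> length (G xs) = n) \<and>
     (\<forall>i<n. rec_in X k (\<lambda>xs. G xs ! i))"

definition dec_in :: "nat set \<Rightarrow> nat \<Rightarrow> (nat list \<Rightarrow> bool) \<Rightarrow> bool" where
  "dec_in X k P \<longleftrightarrow> rec_in X k (\<lambda>xs. of_bool (P xs))"

lemma rec_in_cong:
  assumes "rec_in X k f" "\<And>xs. length xs = k \<Longrightarrow> g xs = f xs"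
  shows "rec_in X k g"
  using assms unfolding rec_in_def by metis

lemma rec_in_nth_self: "i < k \<Longrightarrow> rec_in X k (\<lambda>xs. xs ! i)"
  unfolding rec_in_def by (intro exI[of _ "Proj i"]) (auto intro: eval_Proj)

lemma rec_in_comp:
  assumes f: "rec_in X n f" and G: "recs_in X k n G"
  shows "rec_in X k (\<lambda>xs. f (G xs))"
proof -
  obtain pf where pf: "\<And>xs. length xs = n \<Longrightarrow> \<exists>Q. eval X pf xs (f xs) Q"
    using f unfolding rec_in_def by blast
  have "\<forall>i<n. \<exists>p. \<forall>xs. length xs = k \<longrightarrow> (\<exists>Q. eval X p xs (G xs ! i) Q)"
    using G unfolding recs_in_def rec_in_def by blast
  then obtain pg where pg: "\<And>i xs. i < n \<Longrightarrow> length xs = k \<Longrightarrow> \<exists>Q. eval X (pg i) xs (G xs ! i) Q"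
    by metis
  have "\<exists>Q. eval X (Comp pf (map pg [0..<n])) xs (f (G xs)) Q" if xs: "length xs = k" for xs
  proof -
    have len: "length (G xs) = n" using G xs by (simp add: recs_in_def)
    obtain R where R: "eval X pf (G xs) (f (G xs)) R" using pf[OF len] by blast
    obtain Qs where "\<And>i. i < n \<Longrightarrow> eval X (pg i) xs (G xs ! i) (Qs i)"
      using pg[OF _ xs] by metis
    then show ?thesis
      using eval_Comp[where ys = "G xs" and gs = "map pg [0..<n]" and Qs = Qs and xs = xs, OF _ _ R]
        len by fastforce
  qed
  then show ?thesis unfolding rec_in_def by blast
qed

lemma recs_in_id: "recs_in X k k (\<lambda>xs. xs)"
  by (simp add: recs_in_def rec_in_nth_self)

lemma recs_in_Nil: "recs_in X k 0 (\<lambda>xs. [])"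
  by (simp add: recs_in_def)

lemma recs_in_Cons:
  assumes "rec_in X k g" "recs_in X k n G"
  shows "recs_in X k (Suc n) (\<lambda>xs. g xs # G xs)"
  using assms by (auto simp: recs_in_def less_Suc_eq_0_disj)

lemma recs_in_tl:
  assumes "recs_in X k n G"
  shows "recs_in X k (n - 1) (\<lambda>xs. tl (G xs))"
  unfolding recs_in_def
proof (intro conjI allI impI)
  show "length (tl (G xs)) = n - 1" if "length xs = k" for xs
    using assms that by (simp add: recs_in_def)
  show "rec_in X k (\<lambda>xs. tl (G xs) ! i)" if "i < n - 1" for i
  proof (rule rec_in_cong)
    show "rec_in X k (\<lambda>xs. G xs ! Suc i)" using assms that by (simp add: recs_in_def)
    show "tl (G xs) ! i = G xs ! Suc i" if "length xs = k" for xs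
      using assms that \<open>i < n - 1\<close> by (simp add: recs_in_def nth_tl)
  qed
qed

lemma recs_in_tl_self: "recs_in X k (k - 1) tl"
  using recs_in_tl[OF recs_in_id] .

lemma recs_in_eqI: "recs_in X k m G \<Longrightarrow> m = n \<Longrightarrow> recs_in X k n G"
  by simp

lemma recs_in_map:
  assumes "\<And>g. g \<in> set gs \<Longrightarrow> rec_in X k (F g)"
  shows "recs_in X k (length gs) (\<lambda>xs. map (\<lambda>g. F g xs) gs)"
  using assms by (simp add: recs_in_def)

lemma rec_in_hd:
  assumes "recs_in X k n G" "0 < n"
  shows "rec_in X k (\<lambda>xs. hd (G xs))"
proof (rule rec_in_cong)
  show "rec_in X k (\<lambda>xs. G xs ! 0)" using assms by (simp add: recs_in_def)
  show "hd (G xs) = G xs ! 0" if "length xs = k" for xs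
    using assms that by (cases "G xs") (auto simp: recs_in_def)
qed

lemma rec_in_hd_self: "0 < k \<Longrightarrow> rec_in X k hd"
  using rec_in_hd[OF recs_in_id] .

lemma rec_in_fun1:
  assumes "rec_in X 1 (\<lambda>xs. f (hd xs))" "rec_in X k g"
  shows "rec_in X k (\<lambda>xs. f (g xs))"
  using rec_in_comp[OF assms(1), of k "\<lambda>xs. [g xs]"] recs_in_Cons[OF assms(2) recs_in_Nil] by simp

lemma rec_in_fun2:
  assumes "rec_in X 2 (\<lambda>xs. f (hd xs) (hd (tl xs)))" "rec_in X k g" "rec_in X k h"
  shows "rec_in X k (\<lambda>xs. f (g xs) (h xs))"
  using rec_in_comp[OF assms(1), of k "\<lambda>xs. [g xs, h xs]"]
    recs_in_Cons[OF assms(2) recs_in_Cons[OF assms(3) recs_in_Nil]] by (simp add: numeral_2_eq_2)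

lemma rec_in_Suc:
  assumes "rec_in X k f"
  shows "rec_in X k (\<lambda>xs. Suc (f xs))"
proof (rule rec_in_fun1[OF _ assms])
  show "rec_in X 1 (\<lambda>xs. Suc (hd xs))"
    unfolding rec_in_def
    by (intro exI[of _ Succ]) (auto simp: length_Suc_conv
        intro: eval_Succ[THEN exI[of "eval X Succ _ _"]])
qed

lemma rec_in_const: "rec_in X k (\<lambda>xs. c)"
proof (induction c)
  case 0
  show ?case unfolding rec_in_def by (intro exI[of _ Zero]) (auto intro: eval_Zero)
qed (rule rec_in_Suc)

lemma dec_in_oracle:
  assumes "rec_in X k f"
  shows "dec_in X k (\<lambda>xs. f xs \<in> X)"
  unfolding dec_in_def
proof (rule rec_in_fun1[OF _ assms])
  show "rec_in X 1 (\<lambda>xs. of_bool (hd xs \<in> X))"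
    unfolding rec_in_def
  proof (intro exI[of _ Query] allI impI)
    show "\<exists>Q. eval X Query xs (of_bool (hd xs \<in> X)) Q" if "length xs = 1" for xs
      using that eval_Query[of X "hd xs"] by (auto simp: length_Suc_conv simp del: of_bool_eq_1_iff)
  qed
qed

lemma rec_in_rec_nat:
  assumes f: "rec_in X k f" and b: "rec_in X k b"
    and g: "rec_in X (Suc (Suc k)) (\<lambda>ys. g (hd ys) (hd (tl ys)) (tl (tl ys)))"
  shows "rec_in X k (\<lambda>xs. rec_nat (f xs) (\<lambda>n y. g n y xs) (b xs))"
proof -
  obtain pf where pf: "\<And>xs. length xs = k \<Longrightarrow> \<exists>Q. eval X pf xs (f xs) Q"
    using f unfolding rec_in_def by blast
  obtain pg where pg: "\<And>n y xs. length xs = k \<Longrightarrow> \<exists>Q. eval X pg (n # y # xs) (g n y xs) Q"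
  proof -
    obtain pg where "\<And>ys. length ys = Suc (Suc k) \<Longrightarrow>
        \<exists>Q. eval X pg ys (g (hd ys) (hd (tl ys)) (tl (tl ys))) Q"
      using g unfolding rec_in_def by blast
    from this[of "_ # _ # _"] show thesis by (intro that[of pg]) simp
  qed
  have "\<exists>Q. eval X (PrimRec pf pg) (n # xs) (rec_nat (f xs) (\<lambda>n y. g n y xs) n) Q"
    if xs: "length xs = k" for n xs
  proof (induction n)
    case 0
    then show ?case using pf[OF xs] by (auto intro: eval_PrimRec_0)
  next
    case (Suc n)
    then show ?case using pg[OF xs] by (fastforce intro: eval_PrimRec_Suc)
  qed
  \<comment> \<open>\<open>PrimRec\<close> expects its counter as an extra first argument; composing
    with \<open>b xs # xs\<close> then supplies the number of steps.\<close>
  then have "rec_in X (Suc k) (\<lambda>ys. rec_nat (f (tl ys)) (\<lambda>n y. g n y (tl ys)) (hd ys))"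
    unfolding rec_in_def by (intro exI[of _ "PrimRec pf pg"]) (auto simp: length_Suc_conv)
  from rec_in_comp[OF this recs_in_Cons[OF b recs_in_id]] show ?thesis by simp
qed

lemma rec_in_Least:
  assumes P: "dec_in X (Suc k) (\<lambda>ys. P (hd ys) (tl ys))"
    and ex: "\<And>xs. length xs = k \<Longrightarrow> \<exists>n. P n xs"
  shows "rec_in X k (\<lambda>xs. LEAST n. P n xs)"
proof -
  \<comment> \<open>\<open>Mu\<close> searches for the value 0, so the truth value is negated: the
    recursion gives 0 if \<open>P\<close> holds and 1 otherwise.\<close>
  have "rec_in X (Suc k) (\<lambda>ys. rec_nat 1 (\<lambda>_ _. 0) (of_bool (P (hd ys) (tl ys))))"
    using P by (intro rec_in_rec_nat rec_in_const) (simp add: dec_in_def)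
  then obtain p where p: "\<And>ys. length ys = Suc k \<Longrightarrow>
      \<exists>Q. eval X p ys (rec_nat 1 (\<lambda>_ _. 0) (of_bool (P (hd ys) (tl ys)))) Q"
    unfolding rec_in_def by blast
  have "\<exists>Q. eval X (Mu p) xs (LEAST n. P n xs) Q" if xs: "length xs = k" for xs
  proof -
    let ?m = "LEAST n. P n xs"
    have ev: "\<exists>Q. eval X p (n # xs) (if P n xs then 0 else 1) Q" for n
      using p[of "n # xs"] xs by (auto split: if_splits)
    have "\<exists>Q. eval X p (i # xs) (Suc 0) Q" if "i < ?m" for i
      using ev[of i] not_less_Least[OF that] by simp
    then obtain Qs where Qs: "\<And>i. i < ?m \<Longrightarrow> eval X p (i # xs) (Suc 0) (Qs i)" by metis
    have "P ?m xs" using ex[OF xs] by (rule LeastI_ex)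
    then obtain R where "eval X p (?m # xs) 0 R" using ev[of ?m] by auto
    then show ?thesis using eval_Mu[of ?m X p xs "\<lambda>_. 0" Qs R] Qs by blast
  qed
  then show ?thesis unfolding rec_in_def by blast
qed

lemma rec_in_nth:
  assumes "recs_in X k n G" "i < n"
  shows "rec_in X k (\<lambda>xs. G xs ! i)"
  using assms by (simp add: recs_in_def)

lemmas rec_in_args = recs_in_id recs_in_tl_self rec_in_hd_self recs_in_Nil recs_in_Cons
  recs_in_tl rec_in_hd rec_in_nth rec_in_const

section \<open>Closure under arithmetic, case distinction and bounded sums\<close>

lemma rec_in_add:
  assumes "rec_in X k f" "rec_in X k g"
  shows "rec_in X k (\<lambda>xs. f xs + g xs)"
proof -
  have "rec_in X k (\<lambda>xs. rec_nat (f xs) (\<lambda>n y. Suc y) (g xs))"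
    by (intro rec_in_rec_nat assms rec_in_Suc) (rule rec_in_args | simp)+
  moreover have "rec_nat a (\<lambda>n y. Suc y) b = a + b" for a b :: nat
    by (induction b) auto
  ultimately show ?thesis by simp
qed

lemma rec_in_pred:
  assumes "rec_in X k f"
  shows "rec_in X k (\<lambda>xs. f xs - 1)"
proof -
  have "rec_in X k (\<lambda>xs. rec_nat 0 (\<lambda>n y. n) (f xs))"
    by (intro rec_in_rec_nat assms rec_in_const) (rule rec_in_args | simp)+
  moreover have "rec_nat 0 (\<lambda>n y. n) a = a - 1" for a :: nat
    by (cases a) auto
  ultimately show ?thesis by simp
qed

lemma rec_in_diff:
  assumes "rec_in X k f" "rec_in X k g"
  shows "rec_in X k (\<lambda>xs. f xs - g xs)"
proof -
  have "rec_in X k (\<lambda>xs. rec_nat (f xs) (\<lambda>n y. y - 1) (g xs))"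
    by (intro rec_in_rec_nat assms rec_in_pred) (rule rec_in_args | simp)+
  moreover have "rec_nat a (\<lambda>n y. y - 1) b = a - b" for a b :: nat
    by (induction b) auto
  ultimately show ?thesis by simp
qed

text \<open>Primitive recursion on the truth value: zero steps return \<open>g\<close>, one step
  returns \<open>f\<close>.\<close>

lemma rec_in_if:
  assumes "dec_in X k P" "rec_in X k f" "rec_in X k g"
  shows "rec_in X k (\<lambda>xs. if P xs then f xs else g xs)"
proof -
  have *: "rec_in X (Suc (Suc k)) (\<lambda>ys. f (tl (tl ys)))"
    using rec_in_comp[OF assms(2), of "Suc (Suc k)" "\<lambda>ys. tl (tl ys)"]
      recs_in_tl[OF recs_in_tl_self[of X "Suc (Suc k)"]] by simp
  have "rec_in X k (\<lambda>xs. rec_nat (g xs) (\<lambda>n y. f xs) (of_bool (P xs)))"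
    by (intro rec_in_rec_nat assms * assms(1)[unfolded dec_in_def])
  moreover have "rec_nat (g xs) (\<lambda>n y. f xs) (of_bool (P xs)) = (if P xs then f xs else g xs)" for xs
    by simp
  ultimately show ?thesis by simp
qed

lemma rec_in_sum:
  assumes "rec_in X k b" "rec_in X (Suc k) (\<lambda>ys. f (hd ys) (tl ys))"
  shows "rec_in X k (\<lambda>xs. \<Sum>i<b xs. f i xs)"
proof -
  have *: "rec_in X (Suc (Suc k)) (\<lambda>ys. f (hd ys) (tl (tl ys)))"
    using rec_in_comp[OF assms(2), of "Suc (Suc k)" "\<lambda>ys. hd ys # tl (tl ys)"]
      recs_in_Cons[OF rec_in_hd[OF recs_in_id] recs_in_tl[OF recs_in_tl[OF recs_in_id]],
        of "Suc (Suc k)" X] by simp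
  have "rec_in X k (\<lambda>xs. rec_nat 0 (\<lambda>n y. y + f n xs) (b xs))"
    by (intro rec_in_rec_nat assms rec_in_const rec_in_add *) (rule rec_in_args | simp)+
  moreover have "rec_nat 0 (\<lambda>n y. y + f n xs) b = (\<Sum>i<b. f i xs)" for b xs
    by (induction b) auto
  ultimately show ?thesis by simp
qed

section \<open>Closure of decidable predicates under connectives and bounded quantifiers\<close>

lemma dec_in_fun1:
  assumes "dec_in X 1 (\<lambda>xs. P (hd xs))" "rec_in X k g"
  shows "dec_in X k (\<lambda>xs. P (g xs))"
  using rec_in_fun1[of X "\<lambda>x. of_bool (P x)"] assms by (simp add: dec_in_def)

lemma dec_in_fun2:
  assumes "dec_in X 2 (\<lambda>xs. P (hd xs) (hd (tl xs)))" "rec_in X k g" "rec_in X k h"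
  shows "dec_in X k (\<lambda>xs. P (g xs) (h xs))"
  using rec_in_fun2[of X "\<lambda>x y. of_bool (P x y)"] assms by (simp add: dec_in_def)

lemma dec_in_const: "dec_in X k (\<lambda>xs. c)"
  unfolding dec_in_def by (rule rec_in_const)

lemma dec_in_le:
  assumes "rec_in X k f" "rec_in X k g"
  shows "dec_in X k (\<lambda>xs. f xs \<le> g xs)"
proof -
  have "rec_in X k (\<lambda>xs. 1 - (f xs - g xs))" by (intro rec_in_diff rec_in_const assms)
  then show ?thesis unfolding dec_in_def by (rule rec_in_cong) auto
qed

lemma dec_in_less:
  assumes "rec_in X k f" "rec_in X k g"
  shows "dec_in X k (\<lambda>xs. f xs < g xs)"
  using dec_in_le[OF rec_in_Suc[OF assms(1)] assms(2)] by (simp add: Suc_le_eq)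

lemma dec_in_not:
  assumes "dec_in X k P"
  shows "dec_in X k (\<lambda>xs. \<not> P xs)"
proof -
  have "rec_in X k (\<lambda>xs. 1 - of_bool (P xs))"
    using assms by (intro rec_in_diff rec_in_const) (simp add: dec_in_def)
  then show ?thesis unfolding dec_in_def by (rule rec_in_cong) auto
qed

lemma dec_in_conj:
  assumes "dec_in X k P" "dec_in X k Q"
  shows "dec_in X k (\<lambda>xs. P xs \<and> Q xs)"
proof -
  have "rec_in X k (\<lambda>xs. if P xs then of_bool (Q xs) else 0)"
    using assms by (intro rec_in_if rec_in_const) (simp_all add: dec_in_def)
  then show ?thesis unfolding dec_in_def by (rule rec_in_cong) auto
qed

lemma dec_in_disj:
  assumes "dec_in X k P" "dec_in X k Q"
  shows "dec_in X k (\<lambda>xs. P xs \<or> Q xs)"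
  using dec_in_not[OF dec_in_conj[OF dec_in_not[OF assms(1)] dec_in_not[OF assms(2)]]] by simp

lemma dec_in_imp:
  assumes "dec_in X k P" "dec_in X k Q"
  shows "dec_in X k (\<lambda>xs. P xs \<longrightarrow> Q xs)"
  using dec_in_disj[OF dec_in_not[OF assms(1)] assms(2)] by simp

lemma dec_in_iff:
  assumes "dec_in X k P" "dec_in X k Q"
  shows "dec_in X k (\<lambda>xs. P xs \<longleftrightarrow> Q xs)"
  unfolding iff_conv_conj_imp[of "P _"] by (intro dec_in_conj dec_in_imp assms)

lemma dec_in_eq:
  assumes "rec_in X k f" "rec_in X k g"
  shows "dec_in X k (\<lambda>xs. f xs = g xs)"
  unfolding order.eq_iff[of "f _"] by (intro dec_in_conj dec_in_le assms)

text \<open>A witness exists below the bound iff the sum of the truth values is positive.\<close>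

lemma dec_in_ex_less:
  assumes "rec_in X k b" "dec_in X (Suc k) (\<lambda>ys. P (hd ys) (tl ys))"
  shows "dec_in X k (\<lambda>xs. \<exists>n<b xs. P n xs)"
proof -
  have "dec_in X k (\<lambda>xs. 0 < (\<Sum>i<b xs. of_bool (P i xs) :: nat))"
    using assms by (intro dec_in_less rec_in_sum rec_in_const) (simp_all add: dec_in_def)
  moreover have "0 < (\<Sum>i<b. of_bool (P i xs) :: nat) \<longleftrightarrow> (\<exists>n<b. P n xs)" for b xs
    by (induction b) (auto simp: less_Suc_eq)
  ultimately show ?thesis by simp
qed

lemma dec_in_all_less:
  assumes "rec_in X k b" "dec_in X (Suc k) (\<lambda>ys. P (hd ys) (tl ys))"
  shows "dec_in X k (\<lambda>xs. \<forall>n<b xs. P n xs)"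
  using dec_in_not[OF dec_in_ex_less[OF assms(1) dec_in_not[OF assms(2)]]] by simp

lemma dec_in_Ball_set:
  assumes "\<And>g. g \<in> set gs \<Longrightarrow> dec_in X k (P g)"
  shows "dec_in X k (\<lambda>xs. \<forall>g\<in>set gs. P g xs)"
  using assms by (induction gs) (auto intro: dec_in_const dec_in_conj)

lemmas rec_in_intros = rec_in_args rec_in_Suc rec_in_add rec_in_diff rec_in_if rec_in_sum
  dec_in_const dec_in_le dec_in_less dec_in_not dec_in_conj dec_in_disj dec_in_imp dec_in_iff
  dec_in_eq dec_in_ex_less dec_in_all_less

lemma turing_reducible_iff_dec_in: "Y \<le>\<^sub>T X \<longleftrightarrow> dec_in X 1 (\<lambda>xs. hd xs \<in> Y)"
proof -
  have "(\<forall>n. \<exists>Q. eval X p [n] (of_bool (n \<in> Y)) Q) \<longleftrightarrow>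
      (\<forall>xs. length xs = 1 \<longrightarrow> (\<exists>Q. eval X p xs (of_bool (hd xs \<in> Y)) Q))" for p
    by (auto simp: length_Suc_conv)
  then show ?thesis by (simp add: turing_reducible_def dec_in_def rec_in_def)
qed

lemma computable_rec_in:
  assumes "computable h"
  shows "rec_in X 1 (\<lambda>xs. h (hd xs))"
proof -
  obtain p where p: "oracle_free p" "\<And>n. \<exists>Q. eval {} p [n] (h n) Q"
    using assms unfolding computable_def by blast
  then have "\<exists>Q. eval X p [n] (h n) Q" for n by (meson oracle_free_eval)
  then show ?thesis unfolding rec_in_def by (intro exI[of _ p]) (auto simp: length_Suc_conv)
qed

section \<open>Bounded evaluation of a fixed program\<close>

text \<open>The result 0 stands for divergence and \<open>Suc y\<close> for the output \<open>y\<close>. Only the unbounded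
  search of \<open>Mu\<close> has to be cut off to make evaluation total, so for each fixed program this is a
  computable function of the bound and the input, and no universal program is needed.\<close>

primrec beval :: "nat set \<Rightarrow> nat \<Rightarrow> prog \<Rightarrow> nat list \<Rightarrow> nat" where
  "beval X s Zero = (\<lambda>xs. 1)"
| "beval X s Succ = (\<lambda>xs. if length xs = 1 then Suc (Suc (hd xs)) else 0)"
| "beval X s (Proj i) = (\<lambda>xs. if i < length xs then Suc (xs ! i) else 0)"
| "beval X s Query = (\<lambda>xs. if length xs = 1 then Suc (of_bool (hd xs \<in> X)) else 0)"
| "beval X s (Comp f gs) = (\<lambda>xs. if \<forall>b\<in>set (map (beval X s) gs). b xs \<noteq> 0
     then beval X s f (map (\<lambda>b. b xs - 1) (map (beval X s) gs)) else 0)"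
| "beval X s (PrimRec f g) = (\<lambda>xs. if xs = [] then 0 else
     rec_nat (beval X s f (tl xs))
       (\<lambda>n y. if y = 0 then 0 else beval X s g (n # (y - 1) # tl xs)) (hd xs))"
| "beval X s (Mu f) = (\<lambda>xs. let n = (LEAST n. s \<le> n \<or> beval X s f (n # xs) \<le> 1) in
     if n < s \<and> beval X s f (n # xs) = 1 then Suc n else 0)"

lemma beval_PrimRec_Cons:
  "beval X s (PrimRec f g) (0 # xs) = beval X s f xs"
  "beval X s (PrimRec f g) (Suc n # xs) = (let y = beval X s (PrimRec f g) (n # xs) in
     if y = 0 then 0 else beval X s g (n # (y - 1) # xs))"
  by (simp_all add: Let_def cong: if_cong)

text \<open>The cut-off never invents a result. A search that is cut off yields 0, and 0 propagates
  through every construct; in particular a search that meets a diverging value stops there and fails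
  the final test for 1.\<close>

lemma beval_sound:
  "beval X s p xs = Suc y \<Longrightarrow> \<exists>Q. eval X p xs y Q"
proof (induction p arbitrary: xs y)
  case Zero
  then show ?case by (auto intro: eval_Zero)
next
  case Succ
  then show ?case by (auto simp: length_Suc_conv split: if_splits intro: eval_Succ)
next
  case (Proj i)
  then show ?case by (auto split: if_splits intro: eval_Proj)
next
  case Query
  then show ?case by (auto simp: length_Suc_conv split: if_splits intro: eval_Query)
next
  case (Comp f gs)
  let ?ys = "map (\<lambda>g. beval X s g xs - 1) gs"
  have nz: "\<And>g. g \<in> set gs \<Longrightarrow> beval X s g xs \<noteq> 0" and f: "beval X s f ?ys = Suc y"
    using Comp.prems by (auto split: if_splits simp: comp_def)
  have "\<exists>Q. eval X (gs ! i) xs (?ys ! i) Q" if "i < length gs" for i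
    using Comp.IH(2)[of "gs ! i" xs "?ys ! i"] nz[of "gs ! i"] that by simp
  then obtain Qs where "\<And>i. i < length gs \<Longrightarrow> eval X (gs ! i) xs (?ys ! i) (Qs i)" by metis
  moreover obtain R where "eval X f ?ys y R" using Comp.IH(1)[OF f] by blast
  ultimately show ?case using eval_Comp[of ?ys gs X xs Qs f y R] by auto
next
  case (PrimRec f g)
  obtain n zs where xs: "xs = n # zs" using PrimRec.prems by (cases xs) auto
  have "\<exists>Q. eval X (PrimRec f g) (n # zs) y Q" if "beval X s (PrimRec f g) (n # zs) = Suc y" for n y
    using that
  proof (induction n arbitrary: y)
    case 0
    then have "beval X s f zs = Suc y" by simp
    from PrimRec.IH(1)[OF this] show ?case by (blast intro: eval_PrimRec_0)
  next
    case (Suc n)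
    let ?r = "beval X s (PrimRec f g) (n # zs)"
    have r: "?r = Suc (?r - 1)" "beval X s g (n # (?r - 1) # zs) = Suc y"
      using Suc.prems unfolding beval_PrimRec_Cons Let_def
      by (simp_all del: beval.simps split: if_splits)
    from Suc.IH[OF r(1)] PrimRec.IH(2)[OF r(2)] show ?case by (blast intro: eval_PrimRec_Suc)
  qed
  then show ?case using PrimRec.prems xs by blast
next
  case (Mu f)
  let ?P = "\<lambda>n. s \<le> n \<or> beval X s f (n # xs) \<le> 1"
  let ?n = "LEAST n. ?P n"
  have y: "y = ?n" "?n < s" "beval X s f (?n # xs) = Suc 0"
    using Mu.prems by (auto simp: Let_def split: if_splits)
  obtain R where R: "eval X f (?n # xs) 0 R" using Mu.IH[OF y(3)] by blast
  \<comment> \<open>Below the least index the values exceed 1, so they encode successor outputs, as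
    \<open>eval_Mu\<close> demands.\<close>
  have "\<exists>z Q. eval X f (i # xs) (Suc z) Q" if "i < ?n" for i
  proof -
    have "beval X s f (i # xs) = Suc (Suc (beval X s f (i # xs) - 2))"
      using not_less_Least[OF that] by auto
    then show ?thesis using Mu.IH by blast
  qed
  then obtain zs Qs where "\<And>i. i < ?n \<Longrightarrow> eval X f (i # xs) (Suc (zs i)) (Qs i)" by metis
  then show ?case using eval_Mu[of ?n X f xs zs Qs R] R y(1) by blast
qed

text \<open>The oracle may vary with the bound, as it does when a set is replaced by its stages. A
  halting computation has finitely many subcomputations, so all their eventual conditions hold
  together from some bound on.\<close>

lemma beval_complete:
  assumes "eval X p xs y Q" "\<And>q. q \<in> Q \<Longrightarrow> eventually (\<lambda>s. q \<in> S s \<longleftrightarrow> q \<in> X) sequentially"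
  shows "eventually (\<lambda>s. beval (S s) s p xs = Suc y) sequentially"
  using assms
proof (induction rule: eval.induct)
  case (eval_Query x)
  then have "eventually (\<lambda>s. x \<in> S s \<longleftrightarrow> x \<in> X) sequentially" by simp
  then show ?case by eventually_elim simp
next
  case (eval_Comp ys gs xs Qs f z R)
  have "eventually (\<lambda>s. \<forall>i\<in>{..<length gs}. beval (S s) s (gs ! i) xs = Suc (ys ! i)) sequentially"
    using eval_Comp.IH(1) eval_Comp.prems by (intro eventually_ball_finite) auto
  moreover have "eventually (\<lambda>s. beval (S s) s f ys = Suc z) sequentially"
    using eval_Comp.IH(2) eval_Comp.prems by auto
  ultimately show ?case
  proof eventually_elim
    case (elim s)
    have "map (\<lambda>g. beval (S s) s g xs - 1) gs = ys"
      using elim(1) eval_Comp.hyps(1) by (auto intro: nth_equalityI)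
    moreover have "\<forall>g\<in>set gs. beval (S s) s g xs \<noteq> 0"
      using elim(1) by (auto simp: in_set_conv_nth)
    ultimately show ?case using elim(2) by (simp add: comp_def)
  qed
next
  case (eval_PrimRec_Suc f g n xs y Q z R)
  have "eventually (\<lambda>s. beval (S s) s (PrimRec f g) (n # xs) = Suc y) sequentially"
    "eventually (\<lambda>s. beval (S s) s g (n # y # xs) = Suc z) sequentially"
    using eval_PrimRec_Suc.IH eval_PrimRec_Suc.prems by blast+
  then show ?case unfolding beval_PrimRec_Cons by eventually_elim (simp del: beval.simps)
next
  case (eval_Mu n f xs ys Qs R)
  have "eventually (\<lambda>s. \<forall>i\<in>{..<n}. beval (S s) s f (i # xs) = Suc (Suc (ys i))) sequentially"
    using eval_Mu.IH(1) eval_Mu.prems by (intro eventually_ball_finite) auto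
  moreover have "eventually (\<lambda>s. beval (S s) s f (n # xs) = Suc 0) sequentially"
    using eval_Mu.IH(2) eval_Mu.prems by auto
  moreover have "eventually (\<lambda>s. n < s) sequentially" by (rule eventually_gt_at_top)
  ultimately show ?case
  proof eventually_elim
    case (elim s)
    have "(LEAST m. s \<le> m \<or> beval (S s) s f (m # xs) \<le> 1) = n"
    proof (rule Least_equality)
      show "n \<le> m" if "s \<le> m \<or> beval (S s) s f (m # xs) \<le> 1" for m
      proof (rule ccontr)
        assume "\<not> n \<le> m"
        then have "m < n" by simp
        with elim(1) have "beval (S s) s f (m # xs) = Suc (Suc (ys m))" by blast
        then show False using that \<open>m < n\<close> \<open>n < s\<close> by simp
      qed
    qed (simp add: elim(2))
    then show ?case using elim(2,3) by (simp add: Let_def)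
  qed
qed auto

text \<open>Induction on the fixed program \<open>p\<close>, while the bound \<open>hd ys\<close>
  stays a variable. The arity is generalised because subprograms take argument lists of other
  lengths.\<close>

lemma rec_in_beval:
  assumes S: "dec_in X 2 (\<lambda>ys. hd (tl ys) \<in> S (hd ys))"
  shows "rec_in X (Suc k) (\<lambda>ys. beval (S (hd ys)) (hd ys) p (tl ys))"
proof (induction p arbitrary: k)
  case Zero
  then show ?case by (simp add: rec_in_const)
next
  case Succ
  show ?case
  proof (cases "k = 1")
    case True
    have "rec_in X (Suc k) (\<lambda>ys. Suc (Suc (hd (tl ys))))"
      by (rule rec_in_intros | simp add: True)+
    then show ?thesis by (rule rec_in_cong) (simp add: True)
  next
    case False
    then show ?thesis using rec_in_const[of X "Suc k" 0] by (auto intro: rec_in_cong)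
  qed
next
  case (Proj i)
  show ?case
  proof (cases "i < k")
    case True
    have "rec_in X (Suc k) (\<lambda>ys. Suc (tl ys ! i))"
      by (rule rec_in_intros | simp add: True)+
    then show ?thesis by (rule rec_in_cong) (simp add: True)
  next
    case False
    then show ?thesis using rec_in_const[of X "Suc k" 0] by (auto intro: rec_in_cong)
  qed
next
  case Query
  show ?case
  proof (cases "k = 1")
    case True
    have "dec_in X (Suc k) (\<lambda>ys. hd (tl ys) \<in> S (hd ys))"
      using S True by (simp add: numeral_2_eq_2)
    then have "rec_in X (Suc k) (\<lambda>ys. Suc (of_bool (hd (tl ys) \<in> S (hd ys))))"
      by (intro rec_in_Suc) (simp add: dec_in_def)
    then show ?thesis by (rule rec_in_cong) (simp add: True)
  next
    case False
    then show ?thesis using rec_in_const[of X "Suc k" 0] by (auto intro: rec_in_cong)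
  qed
next
  case (Comp f gs)
  have nz: "dec_in X (Suc k) (\<lambda>ys. \<forall>g\<in>set gs. beval (S (hd ys)) (hd ys) g (tl ys) \<noteq> 0)"
    by (rule dec_in_Ball_set rec_in_intros Comp.IH(2) | assumption)+
  have "recs_in X (Suc k) (Suc (length gs))
      (\<lambda>ys. hd ys # map (\<lambda>g. beval (S (hd ys)) (hd ys) g (tl ys) - 1) gs)"
    by (rule recs_in_Cons recs_in_map rec_in_pred Comp.IH(2) rec_in_hd_self | simp)+
  from rec_in_comp[OF Comp.IH(1) this]
  have "rec_in X (Suc k) (\<lambda>ys. beval (S (hd ys)) (hd ys) f
      (map (\<lambda>g. beval (S (hd ys)) (hd ys) g (tl ys) - 1) gs))" by simp
  from rec_in_if[OF nz this rec_in_const[of _ _ 0]] show ?case by (simp add: comp_def cong: if_cong)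
next
  case (PrimRec f g)
  show ?case
  proof (cases k)
    case 0
    then show ?thesis
      by (intro rec_in_cong[OF rec_in_const[of _ _ 0]]) (auto simp: length_Suc_conv)
  next
    case (Suc m)
    let ?b = "\<lambda>p s xs. beval (S s) s p xs"
    \<comment> \<open>The bound and the arguments are regrouped into one tuple, so that the
      induction hypothesis can be composed with it.\<close>
    have "rec_in X (Suc k) (\<lambda>ys. let vs = hd ys # tl (tl ys) in ?b f (hd vs) (tl vs))"
      unfolding Let_def by (rule rec_in_comp[OF PrimRec.IH(1)[of m] recs_in_eqI])
        (rule rec_in_intros | simp add: Suc)+
    then have f: "rec_in X (Suc k) (\<lambda>ys. ?b f (hd ys) (tl (tl ys)))" by simp
    have "rec_in X (Suc (Suc (Suc k)))
        (\<lambda>zs. let vs = hd (tl (tl zs)) # hd zs # (hd (tl zs) - 1) # tl (tl (tl (tl zs)))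
          in ?b g (hd vs) (tl vs))"
      unfolding Let_def by (rule rec_in_comp[OF PrimRec.IH(2)[of "Suc (Suc m)"] recs_in_eqI])
        (rule rec_in_intros | simp add: Suc)+
    then have g: "rec_in X (Suc (Suc (Suc k)))
        (\<lambda>zs. ?b g (hd (tl (tl zs))) (hd zs # (hd (tl zs) - 1) # tl (tl (tl (tl zs)))))"
      by simp
    have "rec_in X (Suc k) (\<lambda>ys. rec_nat (?b f (hd ys) (tl (tl ys)))
        (\<lambda>n y. if y = 0 then 0 else ?b g (hd ys) (n # (y - 1) # tl (tl ys))) (hd (tl ys)))"
      by (rule f g rec_in_rec_nat rec_in_intros | simp add: Suc)+
    then show ?thesis by (rule rec_in_cong) (auto simp: Suc length_Suc_conv)
  qed
next
  case (Mu f)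
  let ?b = "\<lambda>s xs. beval (S s) s f xs"
  have f: "rec_in X (Suc (Suc k)) (\<lambda>zs. ?b (hd (tl zs)) (hd zs # tl (tl zs)))"
  proof -
    have "rec_in X (Suc (Suc k)) (\<lambda>zs. let vs = hd (tl zs) # hd zs # tl (tl zs)
        in ?b (hd vs) (tl vs))"
      unfolding Let_def by (rule rec_in_comp[OF Mu.IH[of "Suc k"] recs_in_eqI])
        (rule rec_in_intros | simp)+
    then show ?thesis by simp
  qed
  let ?n = "\<lambda>ys. LEAST n. hd ys \<le> n \<or> ?b (hd ys) (n # tl ys) \<le> 1"
  have n: "rec_in X (Suc k) ?n"
    by (rule rec_in_Least, (rule f rec_in_intros | simp)+) auto
  have b: "rec_in X (Suc k) (\<lambda>ys. ?b (hd ys) (?n ys # tl ys))"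
    using rec_in_comp[OF f recs_in_Cons[OF n recs_in_id]] by simp
  have "rec_in X (Suc k) (\<lambda>ys. if ?n ys < hd ys \<and> ?b (hd ys) (?n ys # tl ys) = 1
      then Suc (?n ys) else 0)"
    by (rule n b rec_in_intros | simp)+
  then show ?case unfolding beval.simps Let_def .
qed

lemma rec_in_beval2:
  assumes "dec_in X 2 (\<lambda>ys. hd (tl ys) \<in> S (hd ys))" "rec_in X k f" "rec_in X k g"
  shows "rec_in X k (\<lambda>xs. beval (S (f xs)) (f xs) p [g xs])"
proof -
  have "rec_in X 2 (\<lambda>ys. beval (S (hd ys)) (hd ys) p (tl ys))"
    using rec_in_beval[OF assms(1), of 1 p] by (simp add: numeral_2_eq_2)
  then have "rec_in X 2 (\<lambda>ys. beval (S (hd ys)) (hd ys) p [hd (tl ys)])"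
    by (rule rec_in_cong) (auto simp: length_Suc_conv numeral_2_eq_2)
  from rec_in_fun2[OF this assms(2,3)] show ?thesis .
qed

section \<open>Transitivity of Turing reducibility\<close>

text \<open>Instead of substituting programs for \<open>Query\<close>, bounded evaluation with
  oracle \<open>Y\<close> is carried out in \<open>X\<close>, and \<open>X\<close> searches for a
  bound at which it halts.\<close>

lemma turing_reducible_trans:
  assumes "W \<le>\<^sub>T Y" "Y \<le>\<^sub>T X"
  shows "W \<le>\<^sub>T X"
proof -
  obtain p where p: "\<And>n. \<exists>Q. eval Y p [n] (of_bool (n \<in> W)) Q"
    using assms(1) unfolding turing_reducible_def by blast
  have dec: "dec_in X 2 (\<lambda>ys. hd (tl ys) \<in> (\<lambda>_. Y) (hd ys))"
    by (rule dec_in_fun1[where P = "\<lambda>x. x \<in> Y", OF assms(2)[unfolded turing_reducible_iff_dec_in]]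
        rec_in_intros | simp)+
  have F: "rec_in X k (\<lambda>xs. beval Y (f xs) p [g xs])" if "rec_in X k f" "rec_in X k g" for k f g
    using rec_in_beval2[OF dec that] .
  have halts: "\<exists>s. beval Y s p [n] \<noteq> 0" for n
  proof -
    obtain Q where "eval Y p [n] (of_bool (n \<in> W)) Q" using p by blast
    from eventually_happens'[OF sequentially_bot beval_complete[OF this, of "\<lambda>_. Y"]]
    obtain s where "beval Y s p [n] = Suc (of_bool (n \<in> W))" by auto
    then show ?thesis by (intro exI[of _ s]) simp
  qed
  let ?s = "\<lambda>n. LEAST s. beval Y s p [n] \<noteq> 0"
  have s: "rec_in X 1 (\<lambda>xs. ?s (hd xs))"
    by (rule rec_in_Least, (rule rec_in_intros F | simp)+) (use halts in auto)
  \<comment> \<open>Outputs are shifted by one, so the value 2 means that \<open>p\<close> answers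
    1.\<close>
  have "dec_in X 1 (\<lambda>xs. beval Y (?s (hd xs)) p [hd xs] = 2)"
    by (rule s rec_in_intros F | simp)+
  moreover have "beval Y (?s n) p [n] = 2 \<longleftrightarrow> n \<in> W" for n
  proof -
    have "beval Y (?s n) p [n] \<noteq> 0" using halts by (rule LeastI_ex)
    then obtain y where y: "beval Y (?s n) p [n] = Suc y" using not0_implies_Suc by blast
    then have "y = of_bool (n \<in> W)" using beval_sound p eval_deterministic by blast
    with y show ?thesis by simp
  qed
  ultimately show ?thesis by (simp add: turing_reducible_iff_dec_in)
qed

lemma wtt_reducible_imp_turing_reducible: "X \<le>\<^sub>w\<^sub>t\<^sub>t Y \<Longrightarrow> X \<le>\<^sub>T Y"
  unfolding wtt_reducible_def turing_reducible_def by blast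

section \<open>Stagewise approximations\<close>

text \<open>A computable increasing enumeration. Decidability is asked relative to every oracle so
  that stages can be used inside computations from any separator.\<close>

definition stages :: "nat set \<Rightarrow> (nat \<Rightarrow> nat set) \<Rightarrow> bool" where
  "stages A S \<longleftrightarrow> mono S \<and> A = (\<Union>s. S s) \<and> (\<forall>X. dec_in X 2 (\<lambda>ys. hd (tl ys) \<in> S (hd ys)))"

lemma stages_exist:
  assumes "computably_enumerable A"
  obtains S where "stages A S"
proof -
  obtain p where p: "A = {n. \<exists>y Q. eval {} p [n] y Q}"
    using assms unfolding computably_enumerable_def by blast
  \<comment> \<open>Asking for some smaller bound \<open>t\<close> makes the stages increasing
    without any monotonicity of \<open>beval\<close> in its bound.\<close>
  let ?S = "\<lambda>s. {n. \<exists>t<s. beval {} t p [n] \<noteq> 0}"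
  have "mono ?S" by (rule monoI) (auto intro: less_le_trans)
  moreover have "A = (\<Union>s. ?S s)"
  proof (intro set_eqI iffI)
    show "n \<in> (\<Union>s. ?S s)" if n: "n \<in> A" for n
    proof -
      obtain y Q where "eval {} p [n] y Q" using n p by blast
      from eventually_happens'[OF sequentially_bot beval_complete[OF this, of "\<lambda>_. {}"]]
      obtain t where "beval {} t p [n] = Suc y" by auto
      then have "n \<in> ?S (Suc t)" by auto
      then show ?thesis by blast
    qed
    show "n \<in> A" if "n \<in> (\<Union>s. ?S s)" for n
    proof -
      from that obtain t where "beval {} t p [n] \<noteq> 0" by blast
      then obtain y where "beval {} t p [n] = Suc y" using not0_implies_Suc by blast
      with beval_sound p show ?thesis by blast
    qed
  qed
  moreover have "dec_in X 2 (\<lambda>ys. hd (tl ys) \<in> ?S (hd ys))" for X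
  proof -
    have "rec_in X k (\<lambda>xs. beval {} (f xs) p [g xs])" if "rec_in X k f" "rec_in X k g" for k f g
      using rec_in_beval2[of X "\<lambda>_. {}", OF _ that] by (simp add: dec_in_const)
    note F = this
    show ?thesis unfolding mem_Collect_eq by (rule rec_in_intros F | simp)+
  qed
  ultimately show thesis using that[of ?S] unfolding stages_def by blast
qed

lemma stages_subset: "stages A S \<Longrightarrow> S s \<subseteq> A"
  unfolding stages_def by blast

lemma stages_eventually:
  assumes "stages A S"
  shows "eventually (\<lambda>s. x \<in> S s \<longleftrightarrow> x \<in> A) sequentially"
proof (cases "x \<in> A")
  case True
  then obtain t where "x \<in> S t" using assms unfolding stages_def by blast
  then have "x \<in> S s" if "t \<le> s" for s using assms that unfolding stages_def mono_def by blast
  then show ?thesis using True by (auto simp: eventually_sequentially)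
next
  case False
  then have "x \<in> S s \<longleftrightarrow> x \<in> A" for s using stages_subset[OF assms] by blast
  then show ?thesis by simp
qed

lemma stages_dec_in:
  assumes "stages A S" "rec_in X k f" "rec_in X k g"
  shows "dec_in X k (\<lambda>xs. g xs \<in> S (f xs))"
  using dec_in_fun2[where P = "\<lambda>s x. x \<in> S s"] assms unfolding stages_def by blast

text \<open>\<open>F s n\<close> is the stage \<open>s\<close> answer of the reduction of
  \<open>A\<close> to \<open>B\<close> at \<open>n\<close>, with 0 for no answer. The third clause
  is applied in contrapositive form: a wrong answer at stage \<open>s\<close> forces
  \<open>B\<close> to differ from \<open>T s\<close> below the use bound \<open>h n\<close>.\<close>

definition wtt_stages ::
    "nat set \<Rightarrow> nat set \<Rightarrow> (nat \<Rightarrow> nat set) \<Rightarrow> (nat \<Rightarrow> nat) \<Rightarrow> (nat \<Rightarrow> nat \<Rightarrow> nat) \<Rightarrow> bool" where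
  "wtt_stages A B T h F \<longleftrightarrow> computable h \<and>
     (\<forall>X. rec_in X 2 (\<lambda>ys. F (hd ys) (hd (tl ys)))) \<and>
     (\<forall>s n b. F s n = Suc (of_bool b) \<longrightarrow> (\<forall>q<h n. q \<in> T s \<longleftrightarrow> q \<in> B) \<longrightarrow> b = (n \<in> A)) \<and>
     (\<forall>n. eventually (\<lambda>s. F s n = Suc (of_bool (n \<in> A))) sequentially)"

text \<open>If \<open>T s\<close> is correct below \<open>h n\<close>, the true computation makes
  the same queries and gives the same output with oracle \<open>T s\<close>; determinism then
  identifies this output with the bounded one.\<close>

lemma wtt_reducible_stages:
  assumes "A \<le>\<^sub>w\<^sub>t\<^sub>t B" "stages B T"
  shows "\<exists>h F. wtt_stages A B T h F"
proof -
  obtain p h where h: "computable h" and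
    p: "\<And>n. \<exists>Q. eval B p [n] (of_bool (n \<in> A)) Q \<and> (\<forall>q\<in>Q. q < h n)"
    using assms(1) unfolding wtt_reducible_def by blast
  have "wtt_stages A B T h (\<lambda>s n. beval (T s) s p [n])"
    unfolding wtt_stages_def
  proof (intro conjI allI impI h)
    show "rec_in X 2 (\<lambda>ys. beval (T (hd ys)) (hd ys) p [hd (tl ys)])" for X
      using assms(2) unfolding stages_def
      by (intro rec_in_beval2) (auto intro: rec_in_hd_self rec_in_hd[OF recs_in_tl_self])
    show "b = (n \<in> A)"
      if F: "beval (T s) s p [n] = Suc (of_bool b)" and q: "\<forall>q<h n. q \<in> T s \<longleftrightarrow> q \<in> B" for s n b
    proof -
      obtain Q where Q: "eval B p [n] (of_bool (n \<in> A)) Q" "\<forall>q\<in>Q. q < h n" using p by blast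
      have "eval (T s) p [n] (of_bool (n \<in> A)) Q"
        using eval_use[OF Q(1), of "T s"] Q(2) q by blast
      with beval_sound[OF F] have "(of_bool b :: nat) = of_bool (n \<in> A)"
        using eval_deterministic by blast
      then show ?thesis by (simp add: of_bool_eq_iff)
    qed
    show "eventually (\<lambda>s. beval (T s) s p [n] = Suc (of_bool (n \<in> A))) sequentially" for n
    proof -
      obtain Q where "eval B p [n] (of_bool (n \<in> A)) Q" using p by blast
      then show ?thesis by (rule beval_complete) (rule stages_eventually[OF assms(2)])
    qed
  qed
  then show ?thesis by blast
qed

section \<open>Separators that code a set\<close>

text \<open>Each \<open>x\<close> outside \<open>A \<union> B\<close> carries the bit of
  \<open>C\<close> with index \<open>g x\<close>; several elements may carry the same bit.\<close>

definition coding :: "nat set \<Rightarrow> nat set \<Rightarrow> (nat \<Rightarrow> nat) \<Rightarrow> nat set \<Rightarrow> nat set" where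
  "coding A B g C = A \<union> {x. x \<notin> A \<union> B \<and> g x \<in> C}"

lemma separator_coding: "A \<inter> B = {} \<Longrightarrow> separator (coding A B g C) A B"
  unfolding separator_def coding_def by blast

lemma coding_turing_reducible:
  assumes "A \<le>\<^sub>T C" "B \<le>\<^sub>T C" "rec_in C 1 (\<lambda>xs. g (hd xs))"
  shows "coding A B g C \<le>\<^sub>T C"
proof -
  have "dec_in C 1 (\<lambda>xs. hd xs \<in> A \<or> \<not> (hd xs \<in> A \<or> hd xs \<in> B) \<and> g (hd xs) \<in> C)"
    using assms unfolding turing_reducible_iff_dec_in
    by (intro dec_in_disj dec_in_conj dec_in_not dec_in_oracle)
  then show ?thesis by (simp add: turing_reducible_iff_dec_in coding_def)
qed

lemma sum_of_bool_less: "(\<Sum>j<x. of_bool (j < k) :: nat) = min x k"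
  by (induction x) auto

section \<open>Finitely many gaps: coding one bit per block\<close>

lemma coding_by_blocks:
  assumes S: "stages A S" and T: "stages B T" and disj: "A \<inter> B = {}"
    and red: "A \<le>\<^sub>T C" "B \<le>\<^sub>T C"
    and M: "\<And>X. rec_in X 1 (\<lambda>xs. M (hd xs))" "\<And>x. x < M x"
    and gap: "\<And>m. m0 \<le> m \<Longrightarrow> \<exists>x. m \<le> x \<and> x < M m \<and> x \<notin> A \<union> B"
  shows "\<exists>Z. separator Z A B \<and> Z \<equiv>\<^sub>T C"
proof -
  define b where "b = rec_nat m0 (\<lambda>_ y. M y)"
  \<comment> \<open>Counts the block ends up to \<open>x\<close>. The range \<open>j < x\<close>
    suffices because \<open>k \<le> x\<close> for every \<open>x\<close> in block \<open>k\<close>.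
    Numbers below \<open>m0\<close> get index 0, but decoding never inspects them.\<close>
  define g :: "nat \<Rightarrow> nat" where "g x = (\<Sum>j<x. of_bool (b (Suc j) \<le> x))" for x
  let ?Z = "coding A B g C"
  have b_rec: "rec_in X k (\<lambda>xs. b (f xs))" if "rec_in X k f" for X k f
    unfolding b_def
    by (rule rec_in_rec_nat rec_in_fun1[OF M(1)] rec_in_intros that | simp)+
  have b_Suc: "b (Suc k) = M (b k)" for k by (simp add: b_def)
  have mono: "strict_mono b" by (simp add: strict_mono_Suc_iff b_Suc M(2))
  have m0: "m0 \<le> b k" for k
    using strict_mono_less_eq[OF mono, of 0 k] by (simp add: b_def)
  have g: "g x = k" if "b k \<le> x" "x < b (Suc k)" for x k
  proof -
    have "b (Suc j) \<le> x \<longleftrightarrow> j < k" for j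
    proof
      assume "b (Suc j) \<le> x"
      then have "b (Suc j) < b (Suc k)" using that by linarith
      then show "j < k" using strict_mono_less[OF mono] by simp
    next
      assume "j < k"
      then have "b (Suc j) \<le> b k" using strict_mono_less_eq[OF mono] by simp
      then show "b (Suc j) \<le> x" using that by linarith
    qed
    moreover have "k \<le> x" using strict_mono_imp_increasing[OF mono, of k] that by linarith
    ultimately show ?thesis by (simp add: g_def sum_of_bool_less)
  qed
  have "rec_in C 1 (\<lambda>xs. g (hd xs))"
    unfolding g_def
    by (rule rec_in_sum rec_in_intros b_rec dec_in_le[unfolded dec_in_def] | simp)+
  then have "?Z \<le>\<^sub>T C" using red by (intro coding_turing_reducible)
  moreover have "C \<le>\<^sub>T ?Z"
  proof -
    \<comment> \<open>\<open>?P\<close> certifies that every member of the separator in block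
      \<open>k\<close> lies in \<open>A\<close>, hence bit 0; \<open>?Q\<close> certifies that every
      non-member there lies in \<open>B\<close>, hence bit 1.\<close>
    let ?P = "\<lambda>s k. \<forall>x<b (Suc k). b k \<le> x \<longrightarrow> x \<in> ?Z \<longrightarrow> x \<in> S s"
    let ?Q = "\<lambda>s k. \<forall>x<b (Suc k). b k \<le> x \<longrightarrow> x \<notin> ?Z \<longrightarrow> x \<in> T s"
    have P: "\<exists>s. ?P s k" if "k \<notin> C" for k
    proof -
      have "eventually (\<lambda>s. \<forall>x\<in>{..<b (Suc k)}. x \<in> S s \<longleftrightarrow> x \<in> A) sequentially"
        by (intro eventually_ball_finite) (auto intro: stages_eventually[OF S])
      from eventually_happens'[OF sequentially_bot this]
      obtain s where "\<forall>x\<in>{..<b (Suc k)}. x \<in> S s \<longleftrightarrow> x \<in> A" by blast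
      then have "?P s k" using g that by (auto simp: coding_def)
      then show ?thesis by blast
    qed
    have Q: "\<exists>s. ?Q s k" if "k \<in> C" for k
    proof -
      have "eventually (\<lambda>s. \<forall>x\<in>{..<b (Suc k)}. x \<in> T s \<longleftrightarrow> x \<in> B) sequentially"
        by (intro eventually_ball_finite) (auto intro: stages_eventually[OF T])
      from eventually_happens'[OF sequentially_bot this]
      obtain s where "\<forall>x\<in>{..<b (Suc k)}. x \<in> T s \<longleftrightarrow> x \<in> B" by blast
      then have "?Q s k" using g that by (auto simp: coding_def)
      then show ?thesis by blast
    qed
    \<comment> \<open>An element of the block outside \<open>A \<union> B\<close> is never
      enumerated, so it refutes the wrong certificate at every stage.\<close>
    have gap': "\<exists>x. b k \<le> x \<and> x < b (Suc k) \<and> x \<notin> S s \<and> x \<notin> T s \<and> (x \<in> ?Z \<longleftrightarrow> k \<in> C)" for k s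
    proof -
      obtain x where x: "b k \<le> x" "x < b (Suc k)" "x \<notin> A \<union> B"
        using gap[OF m0, of k] b_Suc by auto
      then have "x \<in> ?Z \<longleftrightarrow> k \<in> C" using g by (simp add: coding_def)
      with x show ?thesis using stages_subset[OF S] stages_subset[OF T] by blast
    qed
    let ?s = "\<lambda>k. LEAST s. ?P s k \<or> ?Q s k"
    have s_rec: "rec_in ?Z 1 (\<lambda>xs. ?s (hd xs))"
    proof (rule rec_in_Least)
      show "dec_in ?Z (Suc 1) (\<lambda>ys. ?P (hd ys) (hd (tl ys)) \<or> ?Q (hd ys) (hd (tl ys)))"
        by (rule rec_in_intros b_rec dec_in_oracle stages_dec_in[OF S] stages_dec_in[OF T] | simp)+
    qed (use P Q in blast)
    have "dec_in ?Z 1 (\<lambda>xs. \<not> ?P (?s (hd xs)) (hd xs))"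
    proof -
      have "dec_in ?Z 2 (\<lambda>xs. \<not> ?P (hd xs) (hd (tl xs)))"
        by (rule rec_in_intros b_rec dec_in_oracle stages_dec_in[OF S] | simp)+
      from dec_in_fun2[where P = "\<lambda>s k. \<not> ?P s k", OF this s_rec rec_in_hd_self]
      show ?thesis by simp
    qed
    moreover have "\<not> ?P (?s k) k \<longleftrightarrow> k \<in> C" for k
    proof -
      have "\<exists>s. ?P s k \<or> ?Q s k" using P Q by blast
      from LeastI_ex[of "\<lambda>s. ?P s k \<or> ?Q s k", OF this]
      have "?P (?s k) k \<or> ?Q (?s k) k" .
      then show ?thesis using gap'[of k "?s k"] by blast
    qed
    ultimately show ?thesis by (simp add: turing_reducible_iff_dec_in)
  qed
  ultimately show ?thesis
    using separator_coding[OF disj] unfolding turing_equivalent_def by blast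
qed

section \<open>Recovering \<open>A\<close> from a separator that is constant on short
  intervals\<close>

text \<open>\<open>M\<close> is obtained before \<open>Z\<close>, since the separators built later
  depend on \<open>M\<close>.\<close>

lemma separator_computes:
  assumes S: "stages A S" and T: "stages B T" and disj: "A \<inter> B = {}"
    and wtt: "A \<equiv>\<^sub>w\<^sub>t\<^sub>t B"
  obtains M where "\<And>X. rec_in X 1 (\<lambda>xs. M (hd xs))" "\<And>x. x < M x" "mono M"
    "\<And>Z. separator Z A B \<Longrightarrow>
       \<forall>w v. w \<notin> A \<union> B \<longrightarrow> v \<notin> A \<union> B \<longrightarrow> w < v \<longrightarrow> v < M w \<longrightarrow> (v \<in> Z \<longleftrightarrow> w \<in> Z) \<Longrightarrow>
       A \<le>\<^sub>T Z"
proof -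
  obtain h F where F: "wtt_stages A B T h F"
    using wtt wtt_reducible_stages[OF _ T] unfolding wtt_equivalent_def by blast
  obtain g G where G: "wtt_stages B A S g G"
    using wtt wtt_reducible_stages[OF _ S] unfolding wtt_equivalent_def by blast
  have h: "computable h" and g: "computable g"
    using F G unfolding wtt_stages_def by auto
  have F_rec: "rec_in X 2 (\<lambda>ys. F (hd ys) (hd (tl ys)))"
    and G_rec: "rec_in X 2 (\<lambda>ys. G (hd ys) (hd (tl ys)))" for X
    using F G unfolding wtt_stages_def by auto
  have F_sound: "b = (n \<in> A)" if "F s n = Suc (of_bool b)" "\<forall>q<h n. q \<in> T s \<longleftrightarrow> q \<in> B" for s n b
    using F that unfolding wtt_stages_def by blast
  have G_sound: "b = (n \<in> B)" if "G s n = Suc (of_bool b)" "\<forall>q<g n. q \<in> S s \<longleftrightarrow> q \<in> A" for s n b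
    using G that unfolding wtt_stages_def by blast
  have F_lim: "eventually (\<lambda>s. F s n = Suc (of_bool (n \<in> A))) sequentially"
    and G_lim: "eventually (\<lambda>s. G s n = Suc (of_bool (n \<in> B))) sequentially" for n
    using F G unfolding wtt_stages_def by auto
  \<comment> \<open>The summand \<open>Suc w\<close> gives \<open>w < M w\<close>; summing the use
    bounds dominates both of them and makes \<open>M\<close> monotone.\<close>
  define M where "M w = Suc w + (\<Sum>i<Suc w. h i + g i)" for w
  have M_rec: "rec_in X k (\<lambda>xs. M (f xs))" if "rec_in X k f" for X k f
    unfolding M_def
  proof (rule rec_in_fun1[OF _ that])
    show "rec_in X 1 (\<lambda>xs. Suc (hd xs) + (\<Sum>i<Suc (hd xs). h i + g i))"
      by (rule rec_in_intros rec_in_fun1[OF computable_rec_in[OF h]]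
          rec_in_fun1[OF computable_rec_in[OF g]] | simp)+
  qed
  have M_h: "h w \<le> M w" and M_g: "g w \<le> M w" for w
    by (simp_all add: M_def)
  have computes: "A \<le>\<^sub>T Z"
    if sep: "separator Z A B"
      and const: "\<forall>w v. w \<notin> A \<union> B \<longrightarrow> v \<notin> A \<union> B \<longrightarrow> w < v \<longrightarrow> v < M w \<longrightarrow> (v \<in> Z \<longleftrightarrow> w \<in> Z)"
    for Z
  proof -
    \<comment> \<open>The test for constancy refers to elements undecided at stage \<open>s\<close>,
      which \<open>Z\<close> can recognise, whereas the assumption on \<open>Z\<close> concerns
      those that are never enumerated.\<close>
    let ?V = "\<lambda>s w. F s w = Suc (of_bool (w \<in> S s)) \<and> G s w = Suc (of_bool (w \<in> T s)) \<and>
      (w \<notin> S s \<and> w \<notin> T s \<longrightarrow>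
        (\<forall>v<M w. w \<le> v \<and> v \<notin> S s \<and> v \<notin> T s \<longrightarrow> (v \<in> Z \<longleftrightarrow> w \<in> Z)))"
    let ?valid = "\<lambda>s x. \<forall>w<Suc x. ?V s w"
    have sub: "S s \<subseteq> A" "T s \<subseteq> B" for s
      using stages_subset[OF S] stages_subset[OF T] by auto
    have sound: "(w \<in> S s \<longleftrightarrow> w \<in> A) \<and> (w \<in> T s \<longleftrightarrow> w \<in> B)" if "?valid s x" "w \<le> x" for s x w
      using that(2)
    proof (induction w rule: less_induct)
      case (less w)
      have "?V s w"
        by (rule mp[OF spec[OF that(1)]]) (use less.prems in \<open>simp only: less_Suc_eq_le\<close>)
      then have V: "F s w = Suc (of_bool (w \<in> S s))"
        "G s w = Suc (of_bool (w \<in> T s))"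
        "\<And>v. w \<notin> S s \<Longrightarrow> w \<notin> T s \<Longrightarrow> v < M w \<Longrightarrow> w \<le> v \<Longrightarrow> v \<notin> S s \<Longrightarrow> v \<notin> T s \<Longrightarrow>
          v \<in> Z \<longleftrightarrow> w \<in> Z"
        by blast+
      \<comment> \<open>By the induction hypothesis stage \<open>s\<close> is correct below
        \<open>w\<close>, so every later change is at \<open>w\<close> or above.\<close>
      have old: "w \<le> q" if "q \<in> B \<and> q \<notin> T s \<or> q \<in> A \<and> q \<notin> S s" for q
      proof (rule ccontr)
        assume "\<not> w \<le> q"
        then have "q < w" "q \<le> x" using less.prems by auto
        with less.IH that show False by blast
      qed
      \<comment> \<open>The reduction still answers that \<open>w\<close> is not in
        \<open>A\<close>, so some \<open>q\<close> below \<open>h w\<close> must enter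
        \<open>B\<close> later. Both \<open>w\<close> and \<open>q\<close> pass as undecided at
        stage \<open>s\<close>, yet only \<open>w\<close> belongs to \<open>Z\<close>.\<close>
      have False if new: "w \<in> A" "w \<notin> S s"
      proof -
        have "\<not> (\<forall>q<h w. q \<in> T s \<longleftrightarrow> q \<in> B)" using F_sound[OF V(1)] new by blast
        then obtain q where q: "q < h w" "q \<in> B" "q \<notin> T s" using sub[of s] by blast
        have "w \<le> q" using old q by blast
        moreover have "q < M w" using q(1) M_h[of w] by simp
        moreover have "w \<notin> T s" "q \<notin> S s" using new q sub[of s] disj by blast+
        ultimately have "q \<in> Z \<longleftrightarrow> w \<in> Z" using V(3) new(2) q(3) by blast
        then show False using new q sep unfolding separator_def by blast
      qed
      moreover have False if new: "w \<in> B" "w \<notin> T s"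
      proof -
        have "\<not> (\<forall>q<g w. q \<in> S s \<longleftrightarrow> q \<in> A)" using G_sound[OF V(2)] new by blast
        then obtain q where q: "q < g w" "q \<in> A" "q \<notin> S s" using sub[of s] by blast
        have "w \<le> q" using old q by blast
        moreover have "q < M w" using q(1) M_g[of w] by simp
        moreover have "w \<notin> S s" "q \<notin> T s" using new q sub[of s] disj by blast+
        ultimately have "q \<in> Z \<longleftrightarrow> w \<in> Z" using V(3) new(2) q(3) by blast
        then show False using new q sep unfolding separator_def by blast
      qed
      ultimately show ?case using sub[of s] by blast
    qed
    have ex: "\<exists>s. ?valid s x" for x
    proof -
      have "eventually (\<lambda>s. ?V s w) sequentially" for w
      proof -
        \<comment> \<open>Once the stage is correct up to \<open>M w\<close>, undecided at the stage
          means outside \<open>A \<union> B\<close>, and the assumption on \<open>Z\<close>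
          applies.\<close>
        have "eventually (\<lambda>s. \<forall>v\<in>{..M w}. (v \<in> S s \<longleftrightarrow> v \<in> A) \<and> (v \<in> T s \<longleftrightarrow> v \<in> B)) sequentially"
          by (intro eventually_ball_finite ballI eventually_conj
              stages_eventually[OF S] stages_eventually[OF T]) simp
        with F_lim[of w] G_lim[of w] show ?thesis
        proof eventually_elim
          case (elim s)
          have w: "(w \<in> S s \<longleftrightarrow> w \<in> A) \<and> (w \<in> T s \<longleftrightarrow> w \<in> B)"
            using elim(3) by (simp add: M_def)
          then have "F s w = Suc (of_bool (w \<in> S s))" "G s w = Suc (of_bool (w \<in> T s))"
            using elim(1,2) by simp_all
          moreover have "v \<in> Z \<longleftrightarrow> w \<in> Z"
            if v: "w \<notin> S s" "w \<notin> T s" "v < M w" "w \<le> v" "v \<notin> S s" "v \<notin> T s" for v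
          proof (cases "w = v")
            case False
            have "v \<notin> A \<union> B" using elim(3) v by simp
            moreover have "w \<notin> A \<union> B" using w v by blast
            ultimately show ?thesis using const False v(3,4) by simp
          qed simp
          ultimately show ?case by blast
        qed
      qed
      then have "eventually (\<lambda>s. \<forall>w\<in>{..<Suc x}. ?V s w) sequentially"
        by (intro eventually_ball_finite) auto
      from eventually_happens'[OF sequentially_bot this] show ?thesis by blast
    qed
    let ?s = "\<lambda>x. LEAST s. ?valid s x"
    have "rec_in Z 1 (\<lambda>xs. ?s (hd xs))"
    proof (rule rec_in_Least)
      show "dec_in Z (Suc 1) (\<lambda>ys. ?valid (hd ys) (hd (tl ys)))"
        by (rule rec_in_intros M_rec rec_in_fun2[OF F_rec] rec_in_fun2[OF G_rec]
            dec_in_oracle stages_dec_in[OF S] stages_dec_in[OF T]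
            dec_in_oracle[unfolded dec_in_def] stages_dec_in[OF S, unfolded dec_in_def]
            stages_dec_in[OF T, unfolded dec_in_def] | simp)+
    qed (use ex in blast)
    from stages_dec_in[OF S this rec_in_hd_self]
    have "dec_in Z 1 (\<lambda>xs. hd xs \<in> S (?s (hd xs)))" by simp
    moreover have "x \<in> S (?s x) \<longleftrightarrow> x \<in> A" for x
    proof -
      have "?valid (?s x) x" by (rule LeastI_ex[of "\<lambda>s. ?valid s x", OF ex])
      from sound[OF this order_refl] show ?thesis by blast
    qed
    ultimately show ?thesis by (simp add: turing_reducible_iff_dec_in)
  qed
  have M_rec1: "rec_in X 1 (\<lambda>xs. M (hd xs))" for X by (intro M_rec rec_in_hd_self) simp
  have M_less: "x < M x" for x by (simp add: M_def)
  have M_mono: "mono M" by (simp add: mono_iff_le_Suc M_def)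
  show thesis by (rule that[OF M_rec1 M_less M_mono]) (rule computes)
qed

section \<open>Infinitely many gaps: coding one bit per stretch between gaps\<close>

text \<open>After such an \<open>e\<close> the separator may change its value without violating the
  constancy required in \<open>separator_computes\<close>.\<close>

definition gap_start :: "nat set \<Rightarrow> nat set \<Rightarrow> (nat \<Rightarrow> nat) \<Rightarrow> nat \<Rightarrow> bool" where
  "gap_start A B M e \<longleftrightarrow> e \<notin> A \<union> B \<and> (\<forall>v<M e. e < v \<longrightarrow> v \<in> A \<union> B)"

lemma coding_between_gaps:
  assumes disj: "A \<inter> B = {}" and red: "A \<le>\<^sub>T C" "B \<le>\<^sub>T A"
    and M: "\<And>X. rec_in X 1 (\<lambda>xs. M (hd xs))" "mono M"
    and computes: "\<And>Z. separator Z A B \<Longrightarrow>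
       \<forall>w v. w \<notin> A \<union> B \<longrightarrow> v \<notin> A \<union> B \<longrightarrow> w < v \<longrightarrow> v < M w \<longrightarrow> (v \<in> Z \<longleftrightarrow> w \<in> Z) \<Longrightarrow>
       A \<le>\<^sub>T Z"
    and gaps: "infinite {e. gap_start A B M e}"
  shows "\<exists>Z. separator Z A B \<and> Z \<equiv>\<^sub>T C"
proof -
  let ?gap = "gap_start A B M"
  \<comment> \<open>The strict bound \<open>e < x\<close> lets a gap start carry the old index; the
    index increases only at its successor.\<close>
  define g :: "nat \<Rightarrow> nat" where "g x = (\<Sum>e<x. of_bool (?gap e))" for x
  let ?Z = "coding A B g C"
  have g_rec: "rec_in X k (\<lambda>xs. g (f xs))" if X: "A \<le>\<^sub>T X" and f: "rec_in X k f" for X k f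
  proof (rule rec_in_fun1[OF _ f])
    have A: "dec_in X k (\<lambda>xs. f xs \<in> A)" and B: "dec_in X k (\<lambda>xs. f xs \<in> B)"
      if "rec_in X k f" for k f
      using dec_in_fun1[OF _ that] X turing_reducible_trans[OF red(2) X]
      by (auto simp: turing_reducible_iff_dec_in)
    have gap: "dec_in X k (\<lambda>xs. ?gap (f xs))" if "rec_in X k f" for k f
    proof (rule dec_in_fun1[OF _ that])
      show "dec_in X 1 (\<lambda>xs. ?gap (hd xs))"
        unfolding gap_start_def Un_iff
        by (rule rec_in_intros A B rec_in_fun1[OF M(1)] | simp)+
    qed
    show "rec_in X 1 (\<lambda>xs. g (hd xs))"
      unfolding g_def
      by (rule rec_in_sum rec_in_hd_self gap[unfolded dec_in_def] | simp)+
  qed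
  have g_eq: "g v = g w" if "w \<le> v" "\<And>e. w \<le> e \<Longrightarrow> e < v \<Longrightarrow> \<not> ?gap e" for v w
    unfolding g_def using that by (intro sum.mono_neutral_right) auto
  \<comment> \<open>Every \<open>e\<close> from \<open>w\<close> up to \<open>v\<close> satisfies
    \<open>v < M w \<le> M e\<close>, so \<open>v\<close> itself keeps \<open>e\<close> from being a
    gap start.\<close>
  have g_const: "g v = g w" if "v \<notin> A \<union> B" "w < v" "v < M w" for v w
  proof (rule g_eq)
    show "\<not> ?gap e" if e: "w \<le> e" "e < v" for e
    proof -
      have "v < M e" using monoD[OF M(2) e(1)] \<open>v < M w\<close> by simp
      then show ?thesis using e(2) \<open>v \<notin> A \<union> B\<close> unfolding gap_start_def by blast
    qed
  qed (use that in simp)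
  \<comment> \<open>The first gap start from \<open>x\<close> on has no gap start between
    \<open>x\<close> and itself, so the count is unchanged.\<close>
  have next_gap: "\<exists>e. ?gap e \<and> g e = g x" for x
  proof -
    have ex: "\<exists>e. x \<le> e \<and> ?gap e" using gaps unfolding finite_nat_set_iff_bounded by (auto simp: not_less)
    let ?e = "LEAST e. x \<le> e \<and> ?gap e"
    have e: "x \<le> ?e" "?gap ?e" using LeastI_ex[OF ex] by auto
    have "g ?e = g x" using not_less_Least by (intro g_eq e(1)) blast
    with e(2) show ?thesis by blast
  qed
  \<comment> \<open>Every bit of \<open>C\<close> must be carried by some element outside
    \<open>A \<union> B\<close>, or it could not be decoded.\<close>
  have g_surj: "\<exists>e. ?gap e \<and> g e = k" for k
  proof (induction k)
    case 0
    show ?case using next_gap[of 0] by (simp add: g_def)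
  next
    case (Suc k)
    then obtain e where "?gap e" "g e = k" by blast
    then have "g (Suc e) = Suc k" by (simp add: g_def)
    then show ?case using next_gap[of "Suc e"] by simp
  qed
  have B_C: "B \<le>\<^sub>T C" using turing_reducible_trans[OF red(2,1)] .
  have "?Z \<le>\<^sub>T C"
    by (intro coding_turing_reducible red(1) B_C g_rec rec_in_hd_self) simp
  moreover have "C \<le>\<^sub>T ?Z"
  proof -
    \<comment> \<open>\<open>A\<close> has to come first: only then are \<open>B\<close>, the gaps
      and \<open>g\<close> available to the separator for decoding.\<close>
    have A_Z: "A \<le>\<^sub>T ?Z"
      using g_const by (intro computes separator_coding disj) (auto simp: coding_def)
    have B_Z: "B \<le>\<^sub>T ?Z" using turing_reducible_trans[OF red(2) A_Z] .
    let ?P = "\<lambda>d k. \<not> (d \<in> A \<or> d \<in> B) \<and> g d = k"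
    let ?d = "\<lambda>k. LEAST d. ?P d k"
    have ex: "\<exists>d. ?P d k" for k using g_surj[of k] unfolding gap_start_def by blast
    have "rec_in ?Z 1 (\<lambda>xs. ?d (hd xs))"
    proof (rule rec_in_Least)
      have A: "dec_in ?Z k (\<lambda>xs. f xs \<in> A)" and B: "dec_in ?Z k (\<lambda>xs. f xs \<in> B)"
        if "rec_in ?Z k f" for k f
        using dec_in_fun1[OF _ that] A_Z B_Z by (auto simp: turing_reducible_iff_dec_in)
      show "dec_in ?Z (Suc 1) (\<lambda>ys. ?P (hd ys) (hd (tl ys)))"
        by (rule rec_in_intros A B g_rec[OF A_Z] | simp)+
    qed (use ex in blast)
    from dec_in_oracle[OF this] have "dec_in ?Z 1 (\<lambda>xs. ?d (hd xs) \<in> ?Z)" .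
    moreover have "?d k \<in> ?Z \<longleftrightarrow> k \<in> C" for k
    proof -
      have "?P (?d k) k" by (rule LeastI_ex[of "\<lambda>d. ?P d k", OF ex])
      then show ?thesis by (simp add: coding_def)
    qed
    ultimately show ?thesis by (simp add: turing_reducible_iff_dec_in)
  qed
  ultimately show ?thesis
    using separator_coding[OF disj] unfolding turing_equivalent_def by blast
qed

text \<open>The last element \<open>w\<close> below \<open>m\<close> outside
  \<open>A \<union> B\<close> is not a gap start once \<open>m\<close> is large. Its window
  therefore contains a later such element, which is at least \<open>m\<close> by maximality and
  below \<open>M w \<le> M m\<close>.\<close>

lemma finitely_many_gaps:
  assumes "finite {e. gap_start A B M e}" "infinite (UNIV - (A \<union> B))" "mono M"
  obtains m0 where "\<And>m. m0 \<le> m \<Longrightarrow> \<exists>x. m \<le> x \<and> x < M m \<and> x \<notin> A \<union> B"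
proof -
  obtain n where n: "\<And>e. gap_start A B M e \<Longrightarrow> e < n"
    using assms(1) unfolding finite_nat_set_iff_bounded by auto
  \<comment> \<open>This \<open>u\<close> lies beyond all gap starts; taking \<open>m\<close> above
    \<open>u\<close> ensures that \<open>w\<close> exists and is at least \<open>u\<close>.\<close>
  obtain u where u: "n \<le> u" "u \<notin> A \<union> B"
    using assms(2) unfolding finite_nat_set_iff_bounded by (auto simp: not_less)
  have "\<exists>x. m \<le> x \<and> x < M m \<and> x \<notin> A \<union> B" if "Suc u \<le> m" for m
  proof -
    let ?W = "{w. w < m \<and> w \<notin> A \<union> B}"
    have W: "finite ?W" "u \<in> ?W" using u that by auto
    define w where "w = Max ?W"
    have "w \<in> ?W" unfolding w_def using W by (intro Max_in) auto
    moreover have "u \<le> w" unfolding w_def using W by (intro Max_ge)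
    ultimately have "w < m" "w \<notin> A \<union> B" "\<not> gap_start A B M w"
      using n[of w] u(1) by auto
    then obtain v where v: "w < v" "v < M w" "v \<notin> A \<union> B" unfolding gap_start_def by blast
    have "v \<notin> ?W" using v(1) Max_ge[OF W(1), of v] unfolding w_def by linarith
    then have "m \<le> v" using v(3) by auto
    moreover have "v < M m" using v(2) monoD[OF assms(3), of w m] \<open>w < m\<close> by simp
    ultimately show ?thesis using v(3) by blast
  qed
  then show thesis by (rule that)
qed

section \<open>Combination of the cases of finitely and infinitely many gaps\<close>

theorem theorem6:
  fixes A B :: "nat set"
  assumes "computably_enumerable A"
    and "computably_enumerable B"
    and "A \<equiv>\<^sub>w\<^sub>t\<^sub>t B"
    and "A \<inter> B = {}"
    and "infinite (UNIV - (A \<union> B))"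
  shows "\<forall>C :: nat set. A \<le>\<^sub>T C \<longrightarrow> (\<exists>Z. separator Z A B \<and> Z \<equiv>\<^sub>T C)"
proof (intro allI impI)
  fix C :: "nat set"
  assume AC: "A \<le>\<^sub>T C"
  have BA: "B \<le>\<^sub>T A"
    using assms(3) wtt_reducible_imp_turing_reducible unfolding wtt_equivalent_def by blast
  obtain S where S: "stages A S" using stages_exist[OF assms(1)] .
  obtain T where T: "stages B T" using stages_exist[OF assms(2)] .
  show "\<exists>Z. separator Z A B \<and> Z \<equiv>\<^sub>T C"
  proof (rule separator_computes[OF S T assms(4,3)])
    fix M
    assume M: "\<And>X. rec_in X 1 (\<lambda>xs. M (hd xs))" "\<And>x. x < M x" "mono M"
      and computes: "\<And>Z. separator Z A B \<Longrightarrow>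
       \<forall>w v. w \<notin> A \<union> B \<longrightarrow> v \<notin> A \<union> B \<longrightarrow> w < v \<longrightarrow> v < M w \<longrightarrow> (v \<in> Z \<longleftrightarrow> w \<in> Z) \<Longrightarrow>
       A \<le>\<^sub>T Z"
    show ?thesis
    proof (cases "finite {e. gap_start A B M e}")
      case True
      obtain m0 where "\<And>m. m0 \<le> m \<Longrightarrow> \<exists>x. m \<le> x \<and> x < M m \<and> x \<notin> A \<union> B"
        using finitely_many_gaps[OF True assms(5) M(3)] by blast
      then show ?thesis
        by (rule coding_by_blocks[OF S T assms(4) AC turing_reducible_trans[OF BA AC] M(1,2)])
    next
      case False
      show ?thesis
        by (rule coding_between_gaps[OF assms(4) AC BA M(1,3) computes False])
    qed
  qed
qed

end
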